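(* Let $(f,C)$ be a low-defect pair of degree $r$, let $s\ge 0$ be real, and let $S=\{(k_1,\ldots,k_r)\in\mathbb{Z}_{\ge0}^r : \delta_{f,C}(k_1,\ldots,k_r)<s\}$. Then there exists a finite set $T\subseteq(\mathbb{Z}_{\ge0}\cup\{*\})^r$ such that: (1) $S=\bigcup_{p\in T}S(p)$; (2) for each $p=(k_1,\ldots,k_r)\in T$, the set of variables $\{x_i : k_i\ne *\}$ is downward closed in the nesting ordering of $f$; consequently the $3$-substitution $(g,D)$ of $p$ into $(f,C)$ is a truncation of $(f,C)$. Moreover $\delta(g,D)\le s$, hence $\deg g\le\lfloor s\rfloor$; and if $\deg g=0$ then $\delta(g,D)<s$.
   Context: $\|n\|$ is the least number of $1$'s needed to write $n\in\mathbb{N}$ using $1$, $+$, $\times$, parentheses. Low-defect expressions: (a) every positive integer constant is one; (b) the product of two low-defect expressions with disjoint variable sets is one; (c) if $E$ is one, $c$ a positive integer and $x$ a variable not in $E$, then $E\cdot x+c$ is one. A low-defect pair is a pair $(f,C)$ where $f$ is the polynomial obtained by evaluating some low-defect expression $E$ and $C\ge\|E\|$, where $\|E\|$ is the sum of the complexities of the integer constants occurring in $E$. Such $f$ (a low-defect polynomial) of degree $r$ is multilinear in $r$ variables with nonnegative integer coefficients, nonzero constant term and nonzero leading coefficient $a$ (coefficient of the product of all variables). Define $\delta(f,C)=C-3\log_3 a$ and $\delta_{f,C}(n_1,\ldots,n_r)=C+3(n_1+\cdots+n_r)-3\log_3 f(3^{n_1},\ldots,3^{n_r})$. Nesting ordering: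 for variables $x,y$ of a low-defect expression $E$, $x\preceq y$ iff $x$ appears in the smallest low-defect subexpression of $E$ containing $y$ (this subexpression has the form $E'\cdot y+c$). This partial order depends only on the polynomial $f$, not on the choice of $E$, and is called the nesting ordering of $f$. A set of variables is downward closed if whenever it contains $y$ and $x\preceq y$ it contains $x$. Direct truncation: if $(f,C)$ is a low-defect pair, $x_i$ is a variable minimal in the nesting ordering, and $k\ge0$ is an integer, the pair $(g,C+3k)$ with $g$ obtained from $f$ by substituting $3^k$ for $x_i$ is a direct truncation of $(f,C)$ (it is again a low-defect pair). A truncation of $(f,C)$ is any pair obtained from $(f,C)$ by a finite sequence (possibly empty) of direct truncations. For $p=(k_1,\ldots,k_r)\in(\mathbb{Z}_{\ge0}\cup\{*\})^r$ (where $*$ is a symbol not a number), $S(p)=\{(\ell_1,\ldots,\ell_r)\in\mathbb{Z}_{\ge0}^r : \ell_i=k_i \text{ whenever } k_i\ne *\}$. The $3$-substitution of $p$ into $(f,C)$ is $(g,D)$ where $g$ is obtained from $f$ by substituting $3^{k_i}$ for $x_i$ whenever $k_i\ne *$, and $D=C+3\sum_{k_i\ne *}k_i$. *)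

theory Defs
  imports Complex_Main "HOL-Library.Poly_Mapping"
begin

section \<open>Integer complexity\<close>

datatype ones_expr = One | Plus ones_expr ones_expr | Times ones_expr ones_expr

primrec ones_val :: "ones_expr \<Rightarrow> nat" where
  "ones_val One = 1"
| "ones_val (Plus a b) = ones_val a + ones_val b"
| "ones_val (Times a b) = ones_val a * ones_val b"

primrec ones_count :: "ones_expr \<Rightarrow> nat" where
  "ones_count One = 1"
| "ones_count (Plus a b) = ones_count a + ones_count b"
| "ones_count (Times a b) = ones_count a + ones_count b"

text \<open>Meaningful for positive arguments only; no expression has value 0.\<close>

definition complexity :: "nat \<Rightarrow> nat" where
  "complexity n = (LEAST k. \<exists>e. ones_val e = n \<and> ones_count e = k)"


section \<open>Polynomials\<close>

text \<open>Polynomials in variables indexed by natural numbers, as elements of the monoid algebra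
  over the monoid of exponent vectors. All polynomials that occur have nonnegative integer
  coefficients.\<close>

type_synonym npoly = "(nat \<Rightarrow>\<^sub>0 nat) \<Rightarrow>\<^sub>0 nat"

definition Var :: "nat \<Rightarrow> npoly" where
  "Var i = Poly_Mapping.single (Poly_Mapping.single i 1) 1"

definition pvars :: "npoly \<Rightarrow> nat set" where
  "pvars f = (\<Union>m \<in> Poly_Mapping.keys f. Poly_Mapping.keys m)"

definition mon_degree :: "(nat \<Rightarrow>\<^sub>0 nat) \<Rightarrow> nat" where
  "mon_degree m = (\<Sum>i \<in> Poly_Mapping.keys m. Poly_Mapping.lookup m i)"

definition pdegree :: "npoly \<Rightarrow> nat" where
  "pdegree f = Max (insert 0 (mon_degree ` Poly_Mapping.keys f))"

text \<open>The target semiring may be a number type, or the polynomial semiring itself: the latter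
  gives substitution of polynomials for the variables.\<close>

definition peval :: "(nat \<Rightarrow> 'a) \<Rightarrow> npoly \<Rightarrow> 'a::comm_semiring_1" where
  "peval \<sigma> f = (\<Sum>m \<in> Poly_Mapping.keys f.
     of_nat (Poly_Mapping.lookup f m) *
       (\<Prod>i \<in> Poly_Mapping.keys m. \<sigma> i ^ Poly_Mapping.lookup m i))"

text \<open>Leading coefficient of a multilinear polynomial: the coefficient of the product of all
  its variables.\<close>

definition lead :: "npoly \<Rightarrow> nat" where
  "lead f = Poly_Mapping.lookup f (\<Sum>i \<in> pvars f. Poly_Mapping.single i 1)"


section \<open>Low-defect expressions and low-defect pairs\<close>

text \<open>The term \<open>LAff E x c\<close> stands for \<open>E \<cdot> x + c\<close>.\<close>

datatype ld_expr = LConst nat | LMul ld_expr ld_expr | LAff ld_expr nat nat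

primrec evars :: "ld_expr \<Rightarrow> nat set" where
  "evars (LConst n) = {}"
| "evars (LMul E F) = evars E \<union> evars F"
| "evars (LAff E x c) = insert x (evars E)"

inductive low_defect_expr :: "ld_expr \<Rightarrow> bool" where
  const: "n > 0 \<Longrightarrow> low_defect_expr (LConst n)"
| mul: "low_defect_expr E \<Longrightarrow> low_defect_expr F \<Longrightarrow> evars E \<inter> evars F = {}
    \<Longrightarrow> low_defect_expr (LMul E F)"
| aff: "low_defect_expr E \<Longrightarrow> c > 0 \<Longrightarrow> x \<notin> evars E \<Longrightarrow> low_defect_expr (LAff E x c)"

primrec expr_poly :: "ld_expr \<Rightarrow> npoly" where
  "expr_poly (LConst n) = of_nat n"
| "expr_poly (LMul E F) = expr_poly E * expr_poly F"
| "expr_poly (LAff E x c) = expr_poly E * Var x + of_nat c"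

primrec expr_complexity :: "ld_expr \<Rightarrow> nat" where
  "expr_complexity (LConst n) = complexity n"
| "expr_complexity (LMul E F) = expr_complexity E + expr_complexity F"
| "expr_complexity (LAff E x c) = expr_complexity E + complexity c"

definition low_defect_pair :: "npoly \<Rightarrow> nat \<Rightarrow> bool" where
  "low_defect_pair f C \<longleftrightarrow>
     (\<exists>E. low_defect_expr E \<and> expr_poly E = f \<and> expr_complexity E \<le> C)"

definition delta :: "npoly \<Rightarrow> nat \<Rightarrow> real" where
  "delta f C = real C - 3 * log 3 (real (lead f))"

text \<open>For a polynomial in the variables \<open>0, \<dots>, r - 1\<close> and a tuple of length \<open>r\<close>.\<close>

definition delta_at :: "npoly \<Rightarrow> nat \<Rightarrow> nat list \<Rightarrow> real" where
  "delta_at f C ns =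
     real C + 3 * real (sum_list ns) - 3 * log 3 (peval (\<lambda>i. 3 ^ (ns ! i)) f)"


section \<open>The nesting ordering\<close>

text \<open>The low-defect subexpressions; \<open>E \<cdot> x\<close> and \<open>x\<close> in \<open>E \<cdot> x + c\<close> are not low-defect.\<close>

primrec subexprs :: "ld_expr \<Rightarrow> ld_expr set" where
  "subexprs (LConst n) = {LConst n}"
| "subexprs (LMul E F) = insert (LMul E F) (subexprs E \<union> subexprs F)"
| "subexprs (LAff E x c) = insert (LAff E x c) (insert (LConst c) (subexprs E))"

definition smallest_subexpr_containing :: "ld_expr \<Rightarrow> nat \<Rightarrow> ld_expr \<Rightarrow> bool" where
  "smallest_subexpr_containing E y F \<longleftrightarrow>
     F \<in> subexprs E \<and> y \<in> evars F \<and> (\<forall>G \<in> subexprs E. y \<in> evars G \<longrightarrow> F \<in> subexprs G)"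

definition expr_nesting :: "ld_expr \<Rightarrow> nat \<Rightarrow> nat \<Rightarrow> bool" where
  "expr_nesting E x y \<longleftrightarrow> (\<exists>F. smallest_subexpr_containing E y F \<and> x \<in> evars F)"

text \<open>The nesting ordering does not depend on the expression that yields \<open>f\<close>, so one may
  quantify existentially over the expressions for \<open>f\<close>.\<close>

definition nesting :: "npoly \<Rightarrow> nat \<Rightarrow> nat \<Rightarrow> bool" where
  "nesting f x y \<longleftrightarrow> (\<exists>E. low_defect_expr E \<and> expr_poly E = f \<and> expr_nesting E x y)"

definition nesting_minimal :: "npoly \<Rightarrow> nat \<Rightarrow> bool" where
  "nesting_minimal f i \<longleftrightarrow> i \<in> pvars f \<and> (\<forall>j \<in> pvars f. nesting f j i \<longrightarrow> j = i)"

definition downward_closed :: "npoly \<Rightarrow> nat set \<Rightarrow> bool" where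
  "downward_closed f A \<longleftrightarrow> (\<forall>x y. y \<in> A \<longrightarrow> nesting f x y \<longrightarrow> x \<in> A)"


section \<open>Truncations and 3-substitutions\<close>

text \<open>Variables keep their indices under substitution; they are not renumbered.\<close>

inductive direct_truncation :: "npoly \<times> nat \<Rightarrow> npoly \<times> nat \<Rightarrow> bool" where
  "low_defect_pair f C \<Longrightarrow> nesting_minimal f i
    \<Longrightarrow> direct_truncation (f, C) (peval (Var(i := 3 ^ k)) f, C + 3 * k)"

definition truncation :: "npoly \<times> nat \<Rightarrow> npoly \<times> nat \<Rightarrow> bool" where
  "truncation = direct_truncation\<^sup>*\<^sup>*"

text \<open>Tuples over \<open>\<nat> \<union> {*}\<close> are lists over \<open>nat option\<close>, with \<open>None\<close> in the role of \<open>*\<close>.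
  The set below is \<open>S(p)\<close>.\<close>

definition points :: "nat option list \<Rightarrow> nat list set" where
  "points p = {l. length l = length p \<and> (\<forall>i < length p. \<forall>k. p ! i = Some k \<longrightarrow> l ! i = k)}"

definition fixed_vars :: "nat option list \<Rightarrow> nat set" where
  "fixed_vars p = {i. i < length p \<and> p ! i \<noteq> None}"

definition subst3_poly :: "nat option list \<Rightarrow> npoly \<Rightarrow> npoly" where
  "subst3_poly p f = peval (\<lambda>i. if i \<in> fixed_vars p then 3 ^ the (p ! i) else Var i) f"

definition subst3_cost :: "nat option list \<Rightarrow> nat \<Rightarrow> nat" where
  "subst3_cost p C = C + 3 * (\<Sum>i \<in> fixed_vars p. the (p ! i))"

end

(* The defect at (n_1, ..., n_r) is C - 3 log_3 of f(3^n_1, ..., 3^n_r) / 3^(n_1 + ... + n_r). This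
   ratio exceeds the leading coefficient a (unless r = 0) and tends to a as soon as the variables
   that are minimal in the nesting ordering become large. So if delta(f, C) <= s and r > 0, every
   point has defect below s and the tuple of stars suffices; if delta(f, C) > s, every point of
   defect below s has some minimal coordinate below a fixed bound K. Fixing that coordinate to each
   of its finitely many values is a direct truncation, which lowers the degree, and one recurses.
   Every constant c of complexity k satisfies c^3 <= 3^k, and each variable brings with it an
   additive constant that costs at least 1 and does not affect a; hence deg f <= delta(f, C). *)

theory Submission imports Defs begin

subsection \<open>Evaluation is a semiring homomorphism\<close>

definition meval :: "(nat \<Rightarrow> 'a) \<Rightarrow> (nat \<Rightarrow>\<^sub>0 nat) \<Rightarrow> 'a::comm_semiring_1" where
  "meval \<sigma> m = (\<Prod>i \<in> Poly_Mapping.keys m. \<sigma> i ^ Poly_Mapping.lookup m i)"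

text \<open>Indices outside the support contribute \<open>\<sigma> i ^ 0 = 1\<close>, so different
  exponent vectors can be handled over one common index set.\<close>

lemma meval_superset:
  assumes "finite S" "Poly_Mapping.keys m \<subseteq> S"
  shows "meval \<sigma> m = (\<Prod>i \<in> S. \<sigma> i ^ Poly_Mapping.lookup m i)"
  unfolding meval_def
  by (rule prod.mono_neutral_left) (use assms in \<open>auto simp: in_keys_iff\<close>)

lemma meval_add: "meval \<sigma> (m + n) = meval \<sigma> m * meval \<sigma> n"
proof -
  let ?S = "Poly_Mapping.keys m \<union> Poly_Mapping.keys n"
  have "meval \<sigma> k = (\<Prod>i \<in> ?S. \<sigma> i ^ Poly_Mapping.lookup k i)" if "k \<in> {m, n, m + n}" for k
    by (rule meval_superset) (use that keys_add[of m n] in auto)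
  then show ?thesis
    by (simp add: lookup_add power_add prod.distrib)
qed

lemma peval_superset:
  assumes "finite S" "Poly_Mapping.keys f \<subseteq> S"
  shows "peval \<sigma> f = (\<Sum>m \<in> S. of_nat (Poly_Mapping.lookup f m) * meval \<sigma> m)"
  unfolding peval_def meval_def
  by (rule sum.mono_neutral_left) (use assms in \<open>auto simp: in_keys_iff\<close>)

lemma peval_add: "peval \<sigma> (f + g) = peval \<sigma> f + peval \<sigma> g"
proof -
  let ?S = "Poly_Mapping.keys f \<union> Poly_Mapping.keys g"
  have "peval \<sigma> h = (\<Sum>m \<in> ?S. of_nat (Poly_Mapping.lookup h m) * meval \<sigma> m)"
    if "h \<in> {f, g, f + g}" for h
    by (rule peval_superset) (use that keys_add[of f g] in auto)
  then show ?thesis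
    by (simp add: lookup_add distrib_right sum.distrib)
qed

lemma peval_0: "peval \<sigma> 0 = 0"
  by (simp add: peval_def)

lemma peval_sum: "peval \<sigma> (\<Sum>x\<in>A. F x) = (\<Sum>x\<in>A. peval \<sigma> (F x))"
  by (induction A rule: infinite_finite_induct) (simp_all add: peval_add peval_0)

lemma peval_single: "peval \<sigma> (Poly_Mapping.single m c) = of_nat c * meval \<sigma> m"
  by (subst peval_superset[of "{m}"]) auto

lemma poly_mapping_sum_single:
  fixes f :: "'a \<Rightarrow>\<^sub>0 'b::comm_monoid_add"
  shows "f = (\<Sum>m \<in> Poly_Mapping.keys f. Poly_Mapping.single m (Poly_Mapping.lookup f m))"
  by (rule poly_mapping_eqI)
    (auto simp: lookup_sum lookup_single when_def in_keys_iff)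

lemma peval_mult: "peval \<sigma> (f * g) = peval \<sigma> f * peval \<sigma> g"
proof -
  let ?s = "\<lambda>f m. Poly_Mapping.single m (Poly_Mapping.lookup f m)"
  have "f * g = (\<Sum>m \<in> Poly_Mapping.keys f. ?s f m) * (\<Sum>n \<in> Poly_Mapping.keys g. ?s g n)"
    using poly_mapping_sum_single[of f] poly_mapping_sum_single[of g] by simp
  also have "\<dots> = (\<Sum>m \<in> Poly_Mapping.keys f. \<Sum>n \<in> Poly_Mapping.keys g.
      Poly_Mapping.single (m + n) (Poly_Mapping.lookup f m * Poly_Mapping.lookup g n))"
    by (simp add: sum_product mult_single)
  finally have "peval \<sigma> (f * g) = (\<Sum>m \<in> Poly_Mapping.keys f. \<Sum>n \<in> Poly_Mapping.keys g.
      (of_nat (Poly_Mapping.lookup f m) * meval \<sigma> m) * (of_nat (Poly_Mapping.lookup g n) * meval \<sigma> n))"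
    by (simp only: peval_sum peval_single meval_add of_nat_mult mult_ac)
  also have "\<dots> = peval \<sigma> f * peval \<sigma> g"
    by (simp only: sum_product peval_superset[OF finite_keys order_refl])
  finally show ?thesis .
qed

lemma of_nat_npoly: "(of_nat n :: 'a::monoid_add \<Rightarrow>\<^sub>0 nat) = Poly_Mapping.single 0 n"
  by (metis of_nat_id single_of_nat)

lemma peval_of_nat: "peval \<sigma> (of_nat n) = of_nat n"
  unfolding of_nat_npoly peval_single by (simp add: meval_def)

lemma peval_1: "peval \<sigma> 1 = 1"
  using peval_of_nat[of \<sigma> 1] by simp

lemma peval_power: "peval \<sigma> (f ^ n) = peval \<sigma> f ^ n"
  by (induction n) (simp_all add: peval_mult peval_1)

lemma peval_numeral: "peval \<sigma> (numeral n) = numeral n"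
  using peval_of_nat[of \<sigma> "numeral n"] by simp

lemma peval_Var: "peval \<sigma> (Var i) = \<sigma> i"
  by (simp add: Var_def peval_single meval_def)

lemmas peval_simps = peval_0 peval_1 peval_add peval_mult peval_power peval_of_nat peval_numeral
  peval_Var

text \<open>With polynomial values for \<open>\<sigma>\<close> this is substitution, so identities
  about \<open>peval\<close> on low-defect polynomials reduce to structural induction on
  expressions.\<close>

primrec expr_val :: "(nat \<Rightarrow> 'a::comm_semiring_1) \<Rightarrow> ld_expr \<Rightarrow> 'a" where
  "expr_val \<sigma> (LConst n) = of_nat n"
| "expr_val \<sigma> (LMul E F) = expr_val \<sigma> E * expr_val \<sigma> F"
| "expr_val \<sigma> (LAff E x c) = expr_val \<sigma> E * \<sigma> x + of_nat c"

lemma peval_expr_poly: "peval \<sigma> (expr_poly E) = expr_val \<sigma> E"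
  by (induction E) (simp_all add: peval_simps)

lemma expr_val_Var: "expr_val Var E = expr_poly E"
  by (induction E) simp_all

lemma peval_expr_val: "peval \<tau> (expr_val \<sigma> E) = expr_val (\<lambda>i. peval \<tau> (\<sigma> i)) E"
  by (induction E) (simp_all add: peval_simps)

subsection \<open>Coefficients\<close>

definition vmon :: "nat set \<Rightarrow> (nat \<Rightarrow>\<^sub>0 nat)" where
  "vmon A = (\<Sum>i \<in> A. Poly_Mapping.single i 1)"

lemma lookup_vmon: "finite A \<Longrightarrow> Poly_Mapping.lookup (vmon A) i = (if i \<in> A then 1 else 0)"
  by (simp add: vmon_def lookup_sum lookup_single when_def)

lemma keys_vmon: "finite A \<Longrightarrow> Poly_Mapping.keys (vmon A) = A"
  by (auto simp: in_keys_iff lookup_vmon split: if_splits)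

lemma vmon_Un: "finite A \<Longrightarrow> finite B \<Longrightarrow> A \<inter> B = {} \<Longrightarrow> vmon (A \<union> B) = vmon A + vmon B"
  by (simp add: vmon_def sum.union_disjoint)

text \<open>The coefficient of the monomial \<open>\<Prod>A\<close>, for \<open>A \<subseteq> evars E\<close>.\<close>

primrec ecoef :: "ld_expr \<Rightarrow> nat set \<Rightarrow> nat" where
  "ecoef (LConst n) A = n"
| "ecoef (LMul E F) A = ecoef E (A \<inter> evars E) * ecoef F (A \<inter> evars F)"
| "ecoef (LAff E x c) A = (if x \<in> A then ecoef E (A - {x}) else if A = {} then c else 0)"

lemma finite_evars: "finite (evars E)"
  by (induction E) simp_all

text \<open>Low-defect polynomials are multilinear: factors of a product share no variable, and
  \<open>x\<close> is new in \<open>LAff E x c\<close>. So sets of variables index the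
  monomials.\<close>

lemma expr_poly_expand:
  "low_defect_expr E \<Longrightarrow>
    expr_poly E = (\<Sum>A \<in> Pow (evars E). Poly_Mapping.single (vmon A) (ecoef E A))"
proof (induction rule: low_defect_expr.induct)
  case (const n)
  then show ?case by (simp add: vmon_def of_nat_npoly[symmetric] del: single_of_nat)
next
  case (mul E F)
  have fin: "finite A" if "A \<subseteq> evars E \<or> A \<subseteq> evars F" for A
    using that finite_evars finite_subset by metis
  have "expr_poly (LMul E F) = (\<Sum>(A, B) \<in> Pow (evars E) \<times> Pow (evars F).
      Poly_Mapping.single (vmon A + vmon B) (ecoef E A * ecoef F B))"
    by (simp add: mul.IH sum_product sum.cartesian_product mult_single)
  also have "\<dots> = (\<Sum>A \<in> Pow (evars E \<union> evars F). Poly_Mapping.single (vmon A)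
      (ecoef E (A \<inter> evars E) * ecoef F (A \<inter> evars F)))"
  \<comment> \<open>Disjointness of the variable sets makes
    \<open>(A, B) \<mapsto> A \<union> B\<close> a bijection, inverted by intersecting with each of
    them.\<close>
  proof (rule sum.reindex_bij_witness[of _ "\<lambda>A. (A \<inter> evars E, A \<inter> evars F)" "\<lambda>(A, B). A \<union> B"],
      goal_cases)
    case (1 p)
    then show ?case using mul.hyps by auto
  next
    case (5 p)
    then obtain A B where p: "p = (A, B)" "A \<subseteq> evars E" "B \<subseteq> evars F"
      by auto
    then have "(A \<union> B) \<inter> evars E = A" "(A \<union> B) \<inter> evars F = B" "A \<inter> B = {}"
      using mul.hyps by auto
    then show ?case using p fin by (simp add: vmon_Un)
  qed auto
  finally show ?case by simp
next
  case (aff E c x)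
  have fin: "finite A" if "A \<subseteq> evars E" for A
    using that finite_evars finite_subset by metis
  let ?s = "\<lambda>A. Poly_Mapping.single (vmon A) (ecoef (LAff E x c) A)"
  have "sum ?s (Pow (evars (LAff E x c))) = sum ?s (Pow (evars E)) + sum ?s (insert x ` Pow (evars E))"
    unfolding evars.simps Pow_insert using aff.hyps finite_evars
    by (subst sum.union_disjoint) auto
  \<comment> \<open>The only term of \<open>E * x + c\<close> without \<open>x\<close> is
    \<open>c\<close>, so nonempty sets avoiding \<open>x\<close> have coefficient 0.\<close>
  also have "sum ?s (Pow (evars E)) = sum ?s {{}}"
    by (rule sum.mono_neutral_right) (use aff.hyps finite_evars in auto)
  also have "\<dots> = of_nat c"
    using aff.hyps by (simp add: vmon_def of_nat_npoly[symmetric] del: single_of_nat)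
  also have "sum ?s (insert x ` Pow (evars E)) = sum (?s \<circ> insert x) (Pow (evars E))"
    by (rule sum.reindex) (use aff.hyps in \<open>auto simp: inj_on_def\<close>)
  also have "\<dots> = (\<Sum>A \<in> Pow (evars E). Poly_Mapping.single (vmon A) (ecoef E A) * Var x)"
  proof (rule sum.cong[OF refl])
    fix A assume "A \<in> Pow (evars E)"
    then have A: "finite A" "x \<notin> A" using fin aff.hyps by auto
    then have "vmon (insert x A) = vmon A + Poly_Mapping.single x 1"
      by (simp add: vmon_def add.commute)
    then show "(?s \<circ> insert x) A = Poly_Mapping.single (vmon A) (ecoef E A) * Var x"
      using A by (simp add: Var_def mult_single)
  qed
  finally show ?case
    using aff.IH by (simp add: sum_distrib_right add.commute)
qed

lemma lookup_expr_poly: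
  assumes "low_defect_expr E" "A \<subseteq> evars E"
  shows "Poly_Mapping.lookup (expr_poly E) (vmon A) = ecoef E A"
proof -
  have fin: "finite A" if "A \<subseteq> evars E" for A
    using that finite_evars finite_subset by metis
  have "Poly_Mapping.lookup (expr_poly E) (vmon A) =
      (\<Sum>B \<in> Pow (evars E). if B = A then ecoef E B else 0)"
    unfolding expr_poly_expand[OF assms(1)] lookup_sum
    by (rule sum.cong[OF refl])
      (auto simp: lookup_single when_def dest: arg_cong[where f = Poly_Mapping.keys]
        simp: keys_vmon fin assms(2))
  then show ?thesis
    using assms finite_evars by simp
qed

lemma keys_expr_poly:
  assumes "low_defect_expr E"
  shows "Poly_Mapping.keys (expr_poly E) = vmon ` {A. A \<subseteq> evars E \<and> ecoef E A \<noteq> 0}"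
proof -
  have "Poly_Mapping.keys (expr_poly E) \<subseteq> vmon ` Pow (evars E)"
    unfolding expr_poly_expand[OF assms]
    by (rule order.trans[OF keys_sum]) (auto split: if_splits)
  then show ?thesis
    using lookup_expr_poly[OF assms] by (auto simp: in_keys_iff)
qed

section \<open>Leading coefficient, constant term, variables and degree\<close>

primrec elead :: "ld_expr \<Rightarrow> nat" where
  "elead (LConst n) = n"
| "elead (LMul E F) = elead E * elead F"
| "elead (LAff E x c) = elead E"

lemma elead_pos: "low_defect_expr E \<Longrightarrow> elead E > 0"
  by (induction rule: low_defect_expr.induct) simp_all

text \<open>The monomial in all variables takes the top term of each factor and never an additive
  constant.\<close>

lemma ecoef_evars: "low_defect_expr E \<Longrightarrow> ecoef E (evars E) = elead E"
proof (induction rule: low_defect_expr.induct)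
  case (mul E F)
  have "(evars E \<union> evars F) \<inter> evars E = evars E" "(evars E \<union> evars F) \<inter> evars F = evars F"
    by auto
  with mul show ?case by simp
qed simp_all

lemma ecoef_empty: "low_defect_expr E \<Longrightarrow> ecoef E {} > 0"
  by (induction rule: low_defect_expr.induct) simp_all

lemma pvars_expr_poly:
  assumes "low_defect_expr E"
  shows "pvars (expr_poly E) = evars E"
proof -
  have "evars E \<in> {A. A \<subseteq> evars E \<and> ecoef E A \<noteq> 0}"
    using ecoef_evars[OF assms] elead_pos[OF assms] by auto
  moreover have "Poly_Mapping.keys (vmon A) = A" if "A \<subseteq> evars E" for A
    using that finite_evars finite_subset keys_vmon by metis
  ultimately show ?thesis
    unfolding pvars_def keys_expr_poly[OF assms] by force
qed

lemma lead_expr_poly: "low_defect_expr E \<Longrightarrow> lead (expr_poly E) = elead E"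
  unfolding lead_def
  using lookup_expr_poly[of E "evars E"] by (simp add: pvars_expr_poly ecoef_evars vmon_def)

lemma pdegree_expr_poly:
  assumes "low_defect_expr E"
  shows "pdegree (expr_poly E) = card (evars E)"
proof -
  have md: "mon_degree (vmon A) = card A" if "A \<subseteq> evars E" for A
  proof -
    have "finite A" using that finite_evars finite_subset by metis
    then show ?thesis by (simp add: mon_degree_def keys_vmon lookup_vmon)
  qed
  have "evars E \<in> {A. A \<subseteq> evars E \<and> ecoef E A \<noteq> 0}"
    using ecoef_evars[OF assms] elead_pos[OF assms] by auto
  then have "vmon (evars E) \<in> Poly_Mapping.keys (expr_poly E)"
    unfolding keys_expr_poly[OF assms] by (rule imageI)
  then have "card (evars E) \<in> mon_degree ` Poly_Mapping.keys (expr_poly E)"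
    using md[OF order_refl] by (metis imageI)
  moreover have "n \<le> card (evars E)" if "n \<in> mon_degree ` Poly_Mapping.keys (expr_poly E)" for n
    using that card_mono[OF finite_evars] by (auto simp: keys_expr_poly[OF assms] md)
  ultimately show ?thesis
    unfolding pdegree_def by (intro Max_eqI) auto
qed

subsection \<open>The nesting ordering does not depend on the expression\<close>

text \<open>The smallest subexpression of \<open>LAff E z c\<close> containing \<open>z\<close> is
  the whole of it, so exactly \<open>z\<close> and the variables of \<open>E\<close> lie below
  \<open>z\<close>.\<close>

primrec enest :: "ld_expr \<Rightarrow> nat \<Rightarrow> nat \<Rightarrow> bool" where
  "enest (LConst n) x y \<longleftrightarrow> False"
| "enest (LMul E F) x y \<longleftrightarrow> enest E x y \<or> enest F x y"
| "enest (LAff E z c) x y \<longleftrightarrow> y = z \<and> x \<in> insert z (evars E) \<or> enest E x y"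

lemma subexprs_refl: "E \<in> subexprs E"
  by (cases E) simp_all

lemma evars_subexprs: "F \<in> subexprs E \<Longrightarrow> evars F \<subseteq> evars E"
  by (induction E) auto

text \<open>The factors share no variable, so \<open>y\<close> occurs in at most one of them, and
  every proper subexpression containing \<open>y\<close> lies inside that factor.\<close>

lemma smallest_subexpr_LMul:
  assumes "evars E \<inter> evars F = {}"
  shows "smallest_subexpr_containing (LMul E F) y G \<longleftrightarrow>
    smallest_subexpr_containing E y G \<or> smallest_subexpr_containing F y G"
    (is "?L \<longleftrightarrow> ?R")
proof
  assume ?L
  then have *: "G \<in> subexprs (LMul E F)" "y \<in> evars G"
    "\<And>H. H \<in> subexprs (LMul E F) \<Longrightarrow> y \<in> evars H \<Longrightarrow> G \<in> subexprs H"
    unfolding smallest_subexpr_containing_def by blast+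
  have "y \<in> evars E \<or> y \<in> evars F"
    using *(1,2) evars_subexprs[of G "LMul E F"] by auto
  then show ?R
  proof
    assume "y \<in> evars E"
    with * subexprs_refl[of E] show ?thesis by (simp add: smallest_subexpr_containing_def)
  next
    assume "y \<in> evars F"
    with * subexprs_refl[of F] show ?thesis by (simp add: smallest_subexpr_containing_def)
  qed
next
  have lift: "G \<in> subexprs H"
    if "smallest_subexpr_containing A y G" "A = E \<and> B = F \<or> A = F \<and> B = E"
      "H \<in> insert (LMul E F) (subexprs A \<union> subexprs B)" "y \<in> evars H" for A B H
  proof -
    have G: "G \<in> subexprs A" "y \<in> evars G" "\<And>H. H \<in> subexprs A \<Longrightarrow> y \<in> evars H
        \<Longrightarrow> G \<in> subexprs H"
      using that(1) unfolding smallest_subexpr_containing_def by blast+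
    then have "y \<notin> evars B"
      using evars_subexprs[of G A] that(2) assms by auto
    then have "H \<notin> subexprs B"
      using evars_subexprs[of H B] that(4) by auto
    then show ?thesis using that G by auto
  qed
  assume ?R
  then show ?L
  proof
    assume "smallest_subexpr_containing E y G"
    with lift[OF this, of F] show ?thesis
      unfolding smallest_subexpr_containing_def subexprs.simps by blast
  next
    assume "smallest_subexpr_containing F y G"
    with lift[OF this, of E] show ?thesis
      unfolding smallest_subexpr_containing_def subexprs.simps by blast
  qed
qed

lemma smallest_subexpr_LAff:
  assumes "z \<notin> evars E"
  shows "smallest_subexpr_containing (LAff E z c) y G \<longleftrightarrow>
    y = z \<and> G = LAff E z c \<or> smallest_subexpr_containing E y G" (is "?L \<longleftrightarrow> ?R")
proof
  assume L: ?L
  then have *: "G \<in> subexprs (LAff E z c)" "y \<in> evars G"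
    "\<And>H. H \<in> subexprs (LAff E z c) \<Longrightarrow> y \<in> evars H \<Longrightarrow> G \<in> subexprs H"
    unfolding smallest_subexpr_containing_def by blast+
  show ?R
  proof (cases "y = z")
    case True
    then have "G \<notin> subexprs E" "G \<noteq> LConst c"
      using *(2) assms evars_subexprs[of G E] by auto
    with *(1) True show ?thesis by simp
  next
    case False
    with *(1,2) have "y \<in> evars E"
      using evars_subexprs[of G "LAff E z c"] by auto
    with * subexprs_refl[of E] show ?thesis
      unfolding smallest_subexpr_containing_def by simp
  qed
next
  assume ?R
  then show ?L
  proof
    assume "y = z \<and> G = LAff E z c"
    moreover have "LAff E z c \<in> subexprs H" if "H \<in> subexprs (LAff E z c)" "z \<in> evars H" for H
    proof -
      have "H \<notin> subexprs E" "H \<noteq> LConst c"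
        using evars_subexprs[of H E] assms that(2) by auto
      with that(1) show ?thesis by simp
    qed
    ultimately show ?thesis by (simp add: smallest_subexpr_containing_def)
  next
    assume "smallest_subexpr_containing E y G"
    then show ?thesis
      using subexprs_refl[of E] unfolding smallest_subexpr_containing_def by auto
  qed
qed

lemma expr_nesting_iff_enest: "low_defect_expr E \<Longrightarrow> expr_nesting E x y \<longleftrightarrow> enest E x y"
proof (induction rule: low_defect_expr.induct)
  case (const n)
  then show ?case by (simp add: expr_nesting_def smallest_subexpr_containing_def)
next
  case (mul E F)
  then show ?case
    unfolding expr_nesting_def by (auto simp: smallest_subexpr_LMul)
next
  case (aff E c x)
  then show ?case
    unfolding expr_nesting_def by (auto simp: smallest_subexpr_LAff)
qed

lemma enest_evars: "enest E x y \<Longrightarrow> x \<in> evars E \<and> y \<in> evars E"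
  by (induction E) auto

text \<open>The right-hand side mentions only which monomials occur, hence only the polynomial. In
  \<open>E * y + c\<close> every term with a variable of \<open>E\<close> also carries
  \<open>y\<close>; conversely, a variable \<open>x\<close> not below \<open>y\<close> has a
  monomial that avoids \<open>y\<close>.\<close>

lemma enest_iff_ecoef:
  assumes "low_defect_expr E"
  shows "enest E x y \<longleftrightarrow> x \<in> evars E \<and> y \<in> evars E \<and>
    (\<forall>A. A \<subseteq> evars E \<longrightarrow> ecoef E A \<noteq> 0 \<longrightarrow> x \<in> A \<longrightarrow> y \<in> A)"
proof -
  have fwd: "y \<in> A" if "enest E x y" "A \<subseteq> evars E" "ecoef E A \<noteq> 0" "x \<in> A" for A
    using assms that
  proof (induction arbitrary: A rule: low_defect_expr.induct)
    case (mul E F)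
    then have "enest E x y \<and> x \<in> A \<inter> evars E \<or> enest F x y \<and> x \<in> A \<inter> evars F"
      using enest_evars by auto
    then show ?case
    proof
      assume "enest E x y \<and> x \<in> A \<inter> evars E"
      then show ?thesis using mul.IH(1)[of "A \<inter> evars E"] mul.prems by simp
    next
      assume "enest F x y \<and> x \<in> A \<inter> evars F"
      then show ?thesis using mul.IH(2)[of "A \<inter> evars F"] mul.prems by simp
    qed
  next
    case (aff E c z)
    show ?case
    proof (cases "z \<in> A")
      case True
      with aff show ?thesis
        using aff.IH[of "A - {z}"] enest_evars[of E x y] by (cases "y = z") auto
    qed (use aff in \<open>auto split: if_splits\<close>)
  qed simp
  have bwd: "\<exists>A \<subseteq> evars E. ecoef E A \<noteq> 0 \<and> x \<in> A \<and> y \<notin> A"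
    if "x \<in> evars E" "y \<in> evars E" "\<not> enest E x y"
    using assms that
  proof (induction rule: low_defect_expr.induct)
    case (mul E F)
    \<comment> \<open>If \<open>y\<close> is absent from a factor, the leading monomial of that
      factor serves.\<close>
    have one: "\<exists>A \<subseteq> evars E. ecoef E A \<noteq> 0 \<and> x \<in> A \<and> y \<notin> A"
      if "low_defect_expr E" "x \<in> evars E" "y \<notin> evars E" for E
      using that ecoef_evars elead_pos by (intro exI[of _ "evars E"]) auto
    from mul.prems consider
      (E) "x \<in> evars E" | (F) "x \<in> evars F" by auto
    then show ?case
    proof cases
      case E
      then have "\<exists>A \<subseteq> evars E. ecoef E A \<noteq> 0 \<and> x \<in> A \<and> y \<notin> A"
        using mul one by (cases "y \<in> evars E") auto
      then obtain A where A: "A \<subseteq> evars E" "ecoef E A \<noteq> 0" "x \<in> A" "y \<notin> A" by blast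
      then have "A \<inter> evars E = A" "A \<inter> evars F = {}" using mul.hyps by auto
      \<comment> \<open>\<open>A\<close> is also a monomial of the product: the other factor
        contributes its nonzero constant term.\<close>
      then show ?thesis using A ecoef_empty[OF mul.hyps(2)] by (intro exI[of _ A]) auto
    next
      case F
      then have "\<exists>A \<subseteq> evars F. ecoef F A \<noteq> 0 \<and> x \<in> A \<and> y \<notin> A"
        using mul one by (cases "y \<in> evars F") auto
      then obtain A where A: "A \<subseteq> evars F" "ecoef F A \<noteq> 0" "x \<in> A" "y \<notin> A" by blast
      then have "A \<inter> evars F = A" "A \<inter> evars E = {}" using mul.hyps by auto
      then show ?thesis using A ecoef_empty[OF mul.hyps(1)] by (intro exI[of _ A]) auto
    qed
  next
    case (aff E c z)
    then have yz: "y \<noteq> z" "y \<in> evars E" by auto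
    show ?case
    proof (cases "x = z")
      case True
      \<comment> \<open>Here \<open>x\<close> is the outermost variable; the monomial
        \<open>z\<close> alone arises from the constant term of \<open>E\<close>.\<close>
      then show ?thesis
        using yz ecoef_empty[OF aff.hyps(1)] by (intro exI[of _ "{z}"]) simp
    next
      case False
      then obtain A where A: "A \<subseteq> evars E" "ecoef E A \<noteq> 0" "x \<in> A" "y \<notin> A"
        using aff by auto
      then have "z \<notin> A" using aff.hyps by auto
      then show ?thesis using A yz by (intro exI[of _ "insert z A"]) auto
    qed
  qed simp
  show ?thesis
    using fwd bwd enest_evars by blast
qed

text \<open>By the characterization through monomials any two expressions of one polynomial give the
  same relation, so the existential in \<open>nesting\<close> can be evaluated at the given
  \<open>E\<close>.\<close>

lemma nesting_expr_poly:
  assumes "low_defect_expr E"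
  shows "nesting (expr_poly E) x y \<longleftrightarrow> enest E x y"
proof -
  have char: "enest F x y \<longleftrightarrow> x \<in> pvars (expr_poly F) \<and> y \<in> pvars (expr_poly F) \<and>
      (\<forall>m \<in> Poly_Mapping.keys (expr_poly F). x \<in> Poly_Mapping.keys m \<longrightarrow> y \<in> Poly_Mapping.keys m)"
    if "low_defect_expr F" for F
  proof -
    have "Poly_Mapping.keys (vmon A) = A" if "A \<subseteq> evars F" for A
      using that finite_evars finite_subset keys_vmon by metis
    then show ?thesis
      unfolding enest_iff_ecoef[OF that] pvars_expr_poly[OF that] keys_expr_poly[OF that]
      by auto
  qed
  show ?thesis
    unfolding nesting_def
    using assms char by (metis expr_nesting_iff_enest)
qed

section \<open>Minimal variables of an expression\<close>

primrec min_vars :: "ld_expr \<Rightarrow> nat set" where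
  "min_vars (LConst n) = {}"
| "min_vars (LMul E F) = min_vars E \<union> min_vars F"
| "min_vars (LAff E x c) = (if evars E = {} then {x} else min_vars E)"

lemma min_vars_subset: "min_vars E \<subseteq> evars E"
  by (induction E) auto

lemma min_vars_nonempty: "evars E \<noteq> {} \<Longrightarrow> min_vars E \<noteq> {}"
  by (induction E) auto

lemma min_vars_minimal:
  "low_defect_expr E \<Longrightarrow> i \<in> min_vars E \<Longrightarrow> enest E j i \<Longrightarrow> j = i"
proof (induction rule: low_defect_expr.induct)
  case (mul E F)
  then show ?case
    using min_vars_subset[of E] min_vars_subset[of F] enest_evars[of E j i] enest_evars[of F j i]
    by auto
next
  case (aff E c x)
  then show ?case
    using min_vars_subset[of E] enest_evars[of E j i] by (auto split: if_splits)
qed simp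

lemma nesting_minimal_min_vars:
  "low_defect_expr E \<Longrightarrow> i \<in> min_vars E \<Longrightarrow> nesting_minimal (expr_poly E) i"
  using min_vars_subset[of E] min_vars_minimal[of E i]
  by (auto simp: nesting_minimal_def pvars_expr_poly nesting_expr_poly)

subsection \<open>Integer complexity\<close>

lemma ones_val_pos: "ones_val e > 0"
  by (induction e) simp_all

lemma ones_count_pos: "ones_count e > 0"
  by (induction e) simp_all

lemma complexity_le: "complexity (ones_val e) \<le> ones_count e"
  unfolding complexity_def by (rule Least_le) blast

lemma complexity_attained:
  assumes "n > 0"
  obtains e where "ones_val e = n" "ones_count e = complexity n"
proof -
  have "\<exists>e. ones_val e = n"
    using assms
  proof (induction n rule: nat_induct_non_zero)
    case 1
    then show ?case by (metis ones_val.simps(1))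
  next
    case (Suc n)
    then show ?case by (metis Suc_eq_plus1 ones_val.simps(1,2))
  qed
  then have "\<exists>k e. ones_val e = n \<and> ones_count e = k" by blast
  from LeastI_ex[OF this] show ?thesis
    using that unfolding complexity_def by blast
qed

lemma complexity_pos: "n > 0 \<Longrightarrow> complexity n > 0"
  by (metis complexity_attained ones_count_pos)

lemma complexity_add: "m > 0 \<Longrightarrow> n > 0 \<Longrightarrow> complexity (m + n) \<le> complexity m + complexity n"
  by (metis complexity_attained complexity_le ones_count.simps(2) ones_val.simps(2))

lemma complexity_mult: "m > 0 \<Longrightarrow> n > 0 \<Longrightarrow> complexity (m * n) \<le> complexity m + complexity n"
  by (metis complexity_attained complexity_le ones_count.simps(3) ones_val.simps(3))

lemma complexity_mult_pow3: "n > 0 \<Longrightarrow> complexity (n * 3 ^ k) \<le> complexity n + 3 * k"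
proof (induction k)
  case (Suc k)
  have "complexity (n * 3 ^ k * 3) \<le> complexity (n * 3 ^ k) + complexity 3"
    using Suc.prems by (intro complexity_mult) auto
  moreover have "complexity 3 \<le> 3"
    using complexity_le[of "Plus (Plus One One) One"] by (simp add: numeral_3_eq_3)
  ultimately show ?case
    using Suc by (simp add: mult_ac)
qed simp

text \<open>The shift \<open>a = b + 3\<close> leaves only nonnegative coefficients. At
  \<open>a = 2\<close> the bound would read \<open>27 \<le> 24\<close>, so small values are treated
  apart where it is applied.\<close>

lemma cube_Suc_le: "a \<ge> 3 \<Longrightarrow> (a + 1) ^ 3 \<le> 3 * a ^ 3" for a :: nat
proof -
  assume "a \<ge> 3"
  then obtain b where "a = b + 3" by (metis add.commute le_Suc_ex)
  then show ?thesis by (simp add: power3_eq_cube algebra_simps)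
qed

text \<open>Products are immediate. A sum of two values at least 2 is at most their product;
  otherwise one summand is 1, and the other grows by 1 at the cost of at least one more
  \<open>One\<close>.\<close>

lemma ones_val_cube: "ones_val e ^ 3 \<le> 3 ^ ones_count e"
proof (induction e)
  case (Plus e f)
  have succ: "(ones_val e + 1) ^ 3 \<le> 3 ^ (ones_count e + ones_count f)"
    if IH: "ones_val e ^ 3 \<le> 3 ^ ones_count e" for e f
  proof -
    note pos = ones_val_pos[of e] ones_count_pos[of e] ones_count_pos[of f]
    consider "ones_val e = 1" | "ones_val e = 2" | "ones_val e \<ge> 3" using pos by linarith
    then show ?thesis
    proof cases
      case 1
      have "3 ^ 2 \<le> (3::nat) ^ (ones_count e + ones_count f)"
        using pos by (intro power_increasing) auto
      with 1 show ?thesis by (simp add: numeral_2_eq_2[symmetric])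
    next
      case 2
      \<comment> \<open>A count of 1 would give \<open>8 \<le> 3\<close>. So the sum uses at least
        three ones, and \<open>3 ^ 3\<close> is exactly the value to be bounded.\<close>
      then have "ones_count e \<ge> 2"
        using IH pos by (cases "ones_count e = 1") auto
      then have "3 ^ 3 \<le> (3::nat) ^ (ones_count e + ones_count f)"
        using pos by (intro power_increasing) auto
      with 2 show ?thesis by simp
    next
      case 3
      have "(ones_val e + 1) ^ 3 \<le> 3 * ones_val e ^ 3" using cube_Suc_le[OF 3] .
      also have "\<dots> \<le> 3 ^ 1 * 3 ^ ones_count e" using IH by simp
      also have "\<dots> \<le> 3 ^ ones_count f * 3 ^ ones_count e"
        using pos by (intro mult_right_mono power_increasing) auto
      finally show ?thesis by (simp add: power_add mult.commute)
    qed
  qed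
  show ?case
  proof (cases "ones_val e = 1 \<or> ones_val f = 1")
    case True
    then show ?thesis
      using succ[of e f] succ[of f e] Plus by (auto simp: add.commute)
  next
    case False
    then have "ones_val e \<ge> 2" "ones_val f \<ge> 2"
      using ones_val_pos[of e] ones_val_pos[of f] by linarith+
    then obtain a b where "ones_val e = a + 2" "ones_val f = b + 2"
      by (metis add.commute le_Suc_ex)
    then have "ones_val e + ones_val f \<le> ones_val e * ones_val f"
      by (simp add: algebra_simps)
    then have "(ones_val e + ones_val f) ^ 3 \<le> (ones_val e * ones_val f) ^ 3"
      by (rule power_mono) simp
    also have "\<dots> \<le> 3 ^ ones_count e * 3 ^ ones_count f"
      unfolding power_mult_distrib by (rule mult_mono) (use Plus in auto)
    finally show ?thesis by (simp add: power_add)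
  qed
next
  case (Times e f)
  then show ?case
    by (simp add: power_mult_distrib power_add mult_mono)
qed simp

lemma complexity_ge_log: "n > 0 \<Longrightarrow> 3 * log 3 (real n) \<le> real (complexity n)"
proof -
  assume n: "n > 0"
  then obtain e where e: "ones_val e = n" "ones_count e = complexity n"
    by (rule complexity_attained)
  have "3 * log 3 (real n) = log 3 (real (n ^ 3))"
    using n by (simp add: log_nat_power)
  also have "\<dots> \<le> log 3 (real (3 ^ complexity n))"
    using n ones_val_cube[of e] unfolding e by (subst log_le_cancel_iff) (simp_all only: of_nat_le_iff, simp_all)
  finally show ?thesis by (simp add: log_nat_power)
qed

text \<open>The \<open>LConst\<close> leaves pay for the leading coefficient by the cube bound; each
  variable comes with an additive constant, whose complexity is at least 1.\<close>

lemma expr_complexity_ge: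
  "low_defect_expr E \<Longrightarrow>
    3 * log 3 (real (elead E)) + real (card (evars E)) \<le> real (expr_complexity E)"
proof (induction rule: low_defect_expr.induct)
  case (const n)
  then show ?case using complexity_ge_log by simp
next
  case (mul E F)
  then show ?case
    using elead_pos[of E] elead_pos[of F] by (simp add: card_Un_disjoint finite_evars log_mult)
next
  case (aff E c x)
  then show ?case
    using complexity_pos[of c] by (simp add: finite_evars)
qed

text \<open>For a variable-free \<open>E\<close> this bounds the cost of collapsing \<open>E\<close>
  to the single constant that is its value.\<close>

lemma complexity_elead_le: "low_defect_expr E \<Longrightarrow> complexity (elead E) \<le> expr_complexity E"
proof (induction rule: low_defect_expr.induct)
  case (mul E F)
  then show ?case
    using complexity_mult[OF elead_pos[of E] elead_pos[of F]] by simp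
qed simp_all

subsection \<open>Substituting a power of 3 for a minimal variable\<close>

text \<open>The case \<open>x = i\<close> is faithful only if \<open>E\<close> has no variables, as
  minimality of \<open>i\<close> ensures; the value of \<open>E\<close> is then
  \<open>elead E\<close>.\<close>

primrec tsubst :: "nat \<Rightarrow> nat \<Rightarrow> ld_expr \<Rightarrow> ld_expr" where
  "tsubst i k (LConst n) = LConst n"
| "tsubst i k (LMul E F) = LMul (tsubst i k E) (tsubst i k F)"
| "tsubst i k (LAff E x c) =
    (if x = i then LConst (elead E * 3 ^ k + c) else LAff (tsubst i k E) x c)"

lemma tsubst_absent: "i \<notin> evars E \<Longrightarrow> tsubst i k E = E"
  by (induction E) auto

lemma expr_val_const: "evars E = {} \<Longrightarrow> expr_val \<sigma> E = of_nat (elead E)"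
  by (induction E) auto

text \<open>This is why a direct truncation is again a low-defect pair: the new constant
  \<open>elead E * 3 ^ k + c\<close> costs at most \<open>3 * k\<close> more than the subexpression
  it replaces, and the surrounding expression keeps its shape.\<close>

lemma tsubst_minimal:
  assumes "low_defect_expr E" "\<And>j. enest E j i \<Longrightarrow> j = i"
  shows evars_tsubst: "evars (tsubst i k E) = evars E - {i}"
    and low_defect_expr_tsubst: "low_defect_expr (tsubst i k E)"
    and expr_poly_tsubst: "expr_poly (tsubst i k E) = expr_val (Var(i := 3 ^ k)) E"
    and expr_complexity_tsubst: "expr_complexity (tsubst i k E) \<le> expr_complexity E + 3 * k"
    and enest_tsubst: "enest E x y \<Longrightarrow> x \<noteq> i \<Longrightarrow> y \<noteq> i \<Longrightarrow> enest (tsubst i k E) x y"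
proof -
  have "evars (tsubst i k E) = evars E - {i} \<and> low_defect_expr (tsubst i k E) \<and>
    expr_poly (tsubst i k E) = expr_val (Var(i := 3 ^ k)) E \<and>
    expr_complexity (tsubst i k E) \<le> expr_complexity E + 3 * k \<and>
    (enest E x y \<longrightarrow> x \<noteq> i \<longrightarrow> y \<noteq> i \<longrightarrow> enest (tsubst i k E) x y)"
    using assms
  proof (induction rule: low_defect_expr.induct)
    case (mul E F)
    have IH: "low_defect_expr (tsubst i k E)" "low_defect_expr (tsubst i k F)"
        "evars (tsubst i k E) = evars E - {i}" "evars (tsubst i k F) = evars F - {i}"
      using mul.IH mul.prems by auto
    have "low_defect_expr (tsubst i k (LMul E F))"
      using IH mul.hyps by (auto intro!: low_defect_expr.mul)
    \<comment> \<open>Only one factor can contain \<open>i\<close>, so the extra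
      \<open>3 * k\<close> is charged once.\<close>
    moreover have "tsubst i k E = E \<or> tsubst i k F = F"
      using mul.hyps tsubst_absent by blast
    ultimately show ?case
      using mul.IH mul.prems by auto
  next
    case (aff E c z)
    show ?case
    proof (cases "z = i")
      case False
      with aff have IH: "low_defect_expr (tsubst i k E)" "evars (tsubst i k E) = evars E - {i}"
        by auto
      have "low_defect_expr (tsubst i k (LAff E z c))"
        using IH aff.hyps False by (auto intro!: low_defect_expr.aff)
      then show ?thesis
        using aff.IH aff.prems False by auto
    next
      case True
      \<comment> \<open>Every variable of \<open>E\<close> is nested below \<open>z = i\<close>, so
        by minimality it equals \<open>z\<close>, which does not occur in \<open>E\<close>.\<close>
      have E: "evars E = {}"
        using aff.prems aff.hyps True by auto
      note pos = elead_pos[OF aff.hyps(1)]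
      have "complexity (elead E * 3 ^ k + c) \<le> complexity (elead E * 3 ^ k) + complexity c"
        using pos aff.hyps by (intro complexity_add) auto
      also have "\<dots> \<le> expr_complexity E + 3 * k + complexity c"
        using complexity_mult_pow3[OF pos, of k] complexity_elead_le[OF aff.hyps(1)] by simp
      finally have "expr_complexity (tsubst i k (LAff E z c)) \<le> expr_complexity (LAff E z c) + 3 * k"
        using True by simp
      moreover have "\<not> enest E x y"
        using E enest_evars by blast
      ultimately show ?thesis
        using True E aff.hyps
        by (auto simp: expr_val_const[OF E] intro: low_defect_expr.const)
    qed
  qed (auto intro: low_defect_expr.const)
  then show "evars (tsubst i k E) = evars E - {i}" "low_defect_expr (tsubst i k E)"
    "expr_poly (tsubst i k E) = expr_val (Var(i := 3 ^ k)) E"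
    "expr_complexity (tsubst i k E) \<le> expr_complexity E + 3 * k"
    "enest E x y \<Longrightarrow> x \<noteq> i \<Longrightarrow> y \<noteq> i \<Longrightarrow> enest (tsubst i k E) x y"
    by blast+
qed

subsection \<open>Approach to the leading coefficient\<close>

text \<open>Dividing by the product of the variables absorbs the term \<open>3 * sum_list ns\<close>
  of \<open>delta_at\<close>.\<close>

definition ratio :: "(nat \<Rightarrow> nat) \<Rightarrow> ld_expr \<Rightarrow> real" where
  "ratio \<sigma> E = expr_val (\<lambda>i. 3 ^ \<sigma> i) E / 3 ^ (\<Sum>i \<in> evars E. \<sigma> i)"

lemma ratio_LMul: "evars E \<inter> evars F = {} \<Longrightarrow> ratio \<sigma> (LMul E F) = ratio \<sigma> E * ratio \<sigma> F"
  by (simp add: ratio_def sum.union_disjoint finite_evars power_add)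

lemma ratio_LAff:
  "x \<notin> evars E \<Longrightarrow>
    ratio \<sigma> (LAff E x c) = ratio \<sigma> E + real c / 3 ^ (\<Sum>i \<in> insert x (evars E). \<sigma> i)"
  by (simp add: ratio_def finite_evars power_add field_simps)

lemma elead_le_ratio: "low_defect_expr E \<Longrightarrow> real (elead E) \<le> ratio \<sigma> E"
proof (induction rule: low_defect_expr.induct)
  case (const n)
  then show ?case by (simp add: ratio_def)
next
  case (mul E F)
  then show ?case by (simp add: ratio_LMul mult_mono')
next
  case (aff E c x)
  then show ?case by (simp add: ratio_LAff add_increasing2)
qed

lemma ratio_pos: "low_defect_expr E \<Longrightarrow> ratio \<sigma> E > 0"
  using elead_le_ratio[of E \<sigma>] elead_pos[of E] by linarith

text \<open>Where there is a variable there is a positive additive constant; in a product of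
  positive quantities one strict factor suffices.\<close>

lemma elead_less_ratio: "low_defect_expr E \<Longrightarrow> evars E \<noteq> {} \<Longrightarrow> real (elead E) < ratio \<sigma> E"
proof (induction rule: low_defect_expr.induct)
  case (mul E F)
  note pos = elead_pos[OF mul.hyps(1)] elead_pos[OF mul.hyps(2)]
    ratio_pos[OF mul.hyps(1), of \<sigma>] ratio_pos[OF mul.hyps(2), of \<sigma>]
  note le = elead_le_ratio[OF mul.hyps(1), of \<sigma>] elead_le_ratio[OF mul.hyps(2), of \<sigma>]
  show ?case
  proof (cases "evars E = {}")
    case True
    then have "real (elead F) < ratio \<sigma> F" using mul by simp
    then have "real (elead E) * real (elead F) < ratio \<sigma> E * ratio \<sigma> F"
      using le pos by (intro mult_le_less_imp_less) auto
    then show ?thesis using mul.hyps by (simp add: ratio_LMul)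
  next
    case False
    then have "real (elead E) < ratio \<sigma> E" using mul by simp
    then have "real (elead E) * real (elead F) < ratio \<sigma> E * ratio \<sigma> F"
      using le pos by (intro mult_less_le_imp_less) auto
    then show ?thesis using mul.hyps by (simp add: ratio_LMul)
  qed
next
  case (aff E c x)
  have "real c / 3 ^ (\<Sum>i \<in> insert x (evars E). \<sigma> i) > 0" using aff.hyps by simp
  then show ?case
    using elead_le_ratio[OF aff.hyps(1), of \<sigma>]
    unfolding ratio_LAff[OF aff.hyps(3)] elead.simps by linarith
qed simp

text \<open>A monomial other than the leading one misses some variable, and with it everything below
  that variable, in particular a minimal variable. So only the minimal variables have to be large.\<close>

lemma ratio_le:
  "low_defect_expr E \<Longrightarrow> \<exists>B \<ge> 0. \<forall>K \<sigma>. (\<forall>i \<in> min_vars E. K \<le> \<sigma> i) \<longrightarrow>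
    ratio \<sigma> E \<le> real (elead E) + B / 3 ^ K"
proof (induction rule: low_defect_expr.induct)
  case (const n)
  then show ?case by (intro exI[of _ 0]) (simp add: ratio_def)
next
  case (mul E F)
  obtain A where A: "A \<ge> 0" "\<And>K \<sigma>. (\<forall>i \<in> min_vars E. K \<le> \<sigma> i) \<Longrightarrow>
      ratio \<sigma> E \<le> real (elead E) + A / 3 ^ K"
    using mul.IH by blast
  obtain B where B: "B \<ge> 0" "\<And>K \<sigma>. (\<forall>i \<in> min_vars F. K \<le> \<sigma> i) \<Longrightarrow>
      ratio \<sigma> F \<le> real (elead F) + B / 3 ^ K"
    using mul.IH by blast
  let ?a = "real (elead E)" and ?b = "real (elead F)"
  \<comment> \<open>The constant collects the cross terms of
    \<open>(?a + A / 3 ^ K) * (?b + B / 3 ^ K)\<close>; the last of them carries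
    \<open>3 ^ K\<close> twice in the denominator, and one copy is dropped.\<close>
  have "ratio \<sigma> (LMul E F) \<le> ?a * ?b + (?a * B + A * ?b + A * B) / 3 ^ K"
    if "\<forall>i \<in> min_vars (LMul E F). K \<le> \<sigma> i" for K \<sigma>
  proof -
    have "ratio \<sigma> (LMul E F) \<le> (?a + A / 3 ^ K) * (?b + B / 3 ^ K)"
      unfolding ratio_LMul[OF mul.hyps(3)]
      using that A B ratio_pos[OF mul.hyps(1), of \<sigma>] ratio_pos[OF mul.hyps(2), of \<sigma>]
      by (intro mult_mono) auto
    also have "\<dots> = ?a * ?b + (?a * B + A * ?b) / 3 ^ K + A * (B / 3 ^ K) / 3 ^ K"
      by (simp add: field_simps)
    also have "A * (B / 3 ^ K) / 3 ^ K \<le> A * B / 3 ^ K"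
    proof -
      have "B / 3 ^ K \<le> B / 1"
        using B by (intro divide_left_mono) auto
      then show ?thesis using A by (intro divide_right_mono mult_left_mono) auto
    qed
    finally show ?thesis by (simp add: add_divide_distrib)
  qed
  then show ?case
    using A(1) B(1) by (intro exI[of _ "?a * B + A * ?b + A * B"]) auto
next
  case (aff E c x)
  obtain B where B: "B \<ge> 0" "\<And>K \<sigma>. (\<forall>i \<in> min_vars E. K \<le> \<sigma> i) \<Longrightarrow>
      ratio \<sigma> E \<le> real (elead E) + B / 3 ^ K"
    using aff.IH by blast
  have "ratio \<sigma> (LAff E x c) \<le> real (elead E) + (B + real c) / 3 ^ K"
    if large: "\<forall>i \<in> min_vars (LAff E x c). K \<le> \<sigma> i" for K \<sigma>
  proof -
    \<comment> \<open>The exponent under \<open>c\<close> sums over all variables, at least one of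
      which is minimal, so it is at least \<open>K\<close>.\<close>
    obtain i where i: "i \<in> min_vars (LAff E x c)"
      using min_vars_nonempty[of "LAff E x c"] by auto
    then have "i \<in> insert x (evars E)"
      using min_vars_subset[of "LAff E x c"] by auto
    then have "\<sigma> i \<le> (\<Sum>i \<in> insert x (evars E). \<sigma> i)"
      by (intro member_le_sum) (auto simp: finite_evars)
    then have "K \<le> (\<Sum>i \<in> insert x (evars E). \<sigma> i)"
      using large i by force
    then have "real c / 3 ^ (\<Sum>i \<in> insert x (evars E). \<sigma> i) \<le> real c / 3 ^ K"
      by (intro divide_left_mono power_increasing) auto
    moreover have "ratio \<sigma> E \<le> real (elead E) + B / 3 ^ K"
      using B(2)[of K \<sigma>] large min_vars_subset[of E] by (auto split: if_splits)
    ultimately show ?thesis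
      using aff.hyps by (simp add: ratio_LAff add_divide_distrib)
  qed
  then show ?case
    using B(1) by (intro exI[of _ "B + real c"]) auto
qed

lemma log_ratio_le:
  assumes "low_defect_expr E" "3 * log 3 (real (elead E)) < t"
  obtains K where "\<And>\<sigma>. (\<And>i. i \<in> min_vars E \<Longrightarrow> K \<le> \<sigma> i) \<Longrightarrow> 3 * log 3 (ratio \<sigma> E) \<le> t"
proof -
  obtain B where B: "B \<ge> 0" "\<And>K \<sigma>. (\<forall>i \<in> min_vars E. K \<le> \<sigma> i) \<Longrightarrow>
      ratio \<sigma> E \<le> real (elead E) + B / 3 ^ K"
    using ratio_le[OF assms(1)] by blast
  \<comment> \<open>\<open>3 powr (t / 3)\<close> is the largest ratio compatible with the bound
    \<open>t\<close>. \<open>gap\<close> is its distance from the limit \<open>elead E\<close>, and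
    \<open>K\<close> is chosen to bring \<open>B / 3 ^ K\<close> within it.\<close>
  define gap where "gap = 3 powr (t / 3) - real (elead E)"
  have "log 3 (real (elead E)) < t / 3" using assms(2) by simp
  then have "real (elead E) < 3 powr (t / 3)"
    using elead_pos[OF assms(1)] by (subst (asm) log_less_iff) auto
  then have gap: "gap > 0"
    by (simp add: gap_def)
  obtain K where K: "B / gap < 3 ^ K"
    using real_arch_pow[of 3 "B / gap"] by auto
  have "3 * log 3 (ratio \<sigma> E) \<le> t" if "\<And>i. i \<in> min_vars E \<Longrightarrow> K \<le> \<sigma> i" for \<sigma>
  proof -
    have "B / 3 ^ K \<le> gap"
      using K gap by (simp add: field_simps)
    then have "ratio \<sigma> E \<le> 3 powr (t / 3)"
      using B(2)[of K \<sigma>] that unfolding gap_def by auto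
    then have "log 3 (ratio \<sigma> E) \<le> t / 3"
      using ratio_pos[OF assms(1), of \<sigma>] by (subst log_le_iff) auto
    then show ?thesis by simp
  qed
  with that show thesis by blast
qed

subsection \<open>Partial substitutions\<close>

text \<open>The invariant of the recursion. The last clause carries the nesting ordering of
  \<open>f\<close> over to the truncated polynomial, where minimality is tested; from it follows
  downward closure with respect to \<open>f\<close> itself.\<close>

definition partial_truncation :: "npoly \<Rightarrow> nat \<Rightarrow> nat \<Rightarrow> nat option list \<Rightarrow> bool" where
  "partial_truncation f C r p \<longleftrightarrow>
     length p = r \<and> downward_closed f (fixed_vars p) \<and>
     truncation (f, C) (subst3_poly p f, subst3_cost p C) \<and>
     low_defect_pair (subst3_poly p f) (subst3_cost p C) \<and>
     pvars (subst3_poly p f) = {..<r} - fixed_vars p \<and>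
     (\<forall>x y. x \<notin> fixed_vars p \<longrightarrow> y \<notin> fixed_vars p \<longrightarrow> nesting f x y \<longrightarrow>
       nesting (subst3_poly p f) x y)"

lemma finite_fixed_vars: "finite (fixed_vars p)"
  by (simp add: fixed_vars_def)

lemma fixed_vars_update:
  "i < length p \<Longrightarrow> fixed_vars (p[i := Some k]) = insert i (fixed_vars p)"
  by (auto simp: fixed_vars_def nth_list_update split: if_splits)

lemma nesting_pvars: "nesting f x y \<Longrightarrow> x \<in> pvars f \<and> y \<in> pvars f"
  unfolding nesting_def using expr_nesting_iff_enest enest_evars pvars_expr_poly by metis

lemma low_defect_pairE:
  assumes "low_defect_pair f C"
  obtains E where "low_defect_expr E" "expr_poly E = f" "expr_complexity E \<le> C"
  using assms by (auto simp: low_defect_pair_def)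

lemma peval_Var_id:
  assumes "low_defect_pair f C"
  shows "peval Var f = f"
  using assms by (auto elim!: low_defect_pairE simp: peval_expr_poly expr_val_Var)

lemma peval_subst:
  assumes "low_defect_pair f C"
  shows "peval \<tau> (peval \<sigma> f) = peval (\<lambda>i. peval \<tau> (\<sigma> i)) f"
  using assms by (auto elim!: low_defect_pairE simp: peval_expr_poly peval_expr_val)

text \<open>Fixing one more coordinate is a substitution into the polynomial reached so far, hence a
  direct truncation if the variable is minimal there.\<close>

lemma subst3_poly_update:
  assumes "low_defect_pair f C" "i < length p" "i \<notin> fixed_vars p"
  shows "subst3_poly (p[i := Some k]) f = peval (Var(i := 3 ^ k)) (subst3_poly p f)"
proof -
  have "(\<lambda>j. if j \<in> fixed_vars (p[i := Some k]) then 3 ^ the (p[i := Some k] ! j) else Var j) =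
    (\<lambda>j. peval (Var(i := 3 ^ k)) (if j \<in> fixed_vars p then 3 ^ the (p ! j) else Var j))"
  proof
    fix j
    have "p[i := Some k] ! j = p ! j" if "j \<in> fixed_vars p"
      using that assms(3) by (metis nth_list_update_neq)
    then show "(if j \<in> fixed_vars (p[i := Some k]) then 3 ^ the (p[i := Some k] ! j) else Var j) =
        peval (Var(i := 3 ^ k)) (if j \<in> fixed_vars p then 3 ^ the (p ! j) else Var j)"
      using assms(2,3) by (cases "j = i") (simp_all add: fixed_vars_update peval_simps)
  qed
  then show ?thesis
    unfolding subst3_poly_def peval_subst[OF assms(1)] by simp
qed

lemma subst3_cost_update:
  assumes "i < length p" "i \<notin> fixed_vars p"
  shows "subst3_cost (p[i := Some k]) C = subst3_cost p C + 3 * k"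
proof -
  have "(\<Sum>j \<in> fixed_vars p. the (p[i := Some k] ! j)) = (\<Sum>j \<in> fixed_vars p. the (p ! j))"
    using assms by (intro sum.cong refl) (metis nth_list_update_neq)
  then show ?thesis
    using assms by (simp add: subst3_cost_def fixed_vars_update finite_fixed_vars)
qed

text \<open>The start of the recursion: the tuple of stars substitutes nothing, and the sequence of
  truncations is empty.\<close>

lemma partial_truncation_replicate:
  assumes "low_defect_pair f C" "pvars f = {..<r}"
  shows "partial_truncation f C r (replicate r None)"
proof -
  have "fixed_vars (replicate r None) = {}"
    by (auto simp: fixed_vars_def)
  moreover from this have "subst3_poly (replicate r None) f = f"
    using peval_Var_id[OF assms(1)] by (simp add: subst3_poly_def)
  ultimately show ?thesis
    using assms
    by (simp add: partial_truncation_def downward_closed_def truncation_def subst3_cost_def)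
qed

lemma partial_truncation_update:
  assumes f: "low_defect_pair f C" and p: "partial_truncation f C r p"
    and i: "nesting_minimal (subst3_poly p f) i"
  shows "partial_truncation f C r (p[i := Some k])"
proof -
  let ?g = "subst3_poly p f" and ?D = "subst3_cost p C" and ?q = "p[i := Some k]"
  obtain E where E: "low_defect_expr E" "expr_poly E = ?g" "expr_complexity E \<le> ?D"
    using p low_defect_pairE unfolding partial_truncation_def by metis
  have len: "length p = r" and pv: "pvars ?g = {..<r} - fixed_vars p"
    and trans: "\<And>x y. x \<notin> fixed_vars p \<Longrightarrow> y \<notin> fixed_vars p \<Longrightarrow> nesting f x y \<Longrightarrow> nesting ?g x y"
    using p unfolding partial_truncation_def by blast+
  have "i \<in> pvars ?g"
    using i by (simp add: nesting_minimal_def)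
  then have ip: "i < length p" "i \<notin> fixed_vars p"
    using pv len by auto
  have nest: "nesting ?g x y \<longleftrightarrow> enest E x y" for x y
    using nesting_expr_poly[OF E(1)] E(2) by simp
  \<comment> \<open>\<open>nesting_minimal\<close> quantifies over \<open>pvars\<close> only, but
    \<open>nesting\<close> relates no other indices.\<close>
  have imin: "j = i" if "nesting ?g j i" for j
    using i that nesting_pvars unfolding nesting_minimal_def by blast
  then have min: "j = i" if "enest E j i" for j
    using that nest by blast
  note ts = evars_tsubst[OF E(1) min] low_defect_expr_tsubst[OF E(1) min]
    expr_poly_tsubst[OF E(1) min] expr_complexity_tsubst[OF E(1) min] enest_tsubst[OF E(1) min]
  have g': "subst3_poly ?q f = peval (Var(i := 3 ^ k)) ?g"
    by (rule subst3_poly_update[OF f ip])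
  have D': "subst3_cost ?q C = ?D + 3 * k"
    by (rule subst3_cost_update[OF ip])
  have fixed: "fixed_vars ?q = insert i (fixed_vars p)"
    by (rule fixed_vars_update[OF ip(1)])
  have q: "subst3_poly ?q f = expr_poly (tsubst i k E)"
    using ts(3) peval_expr_poly[of _ E] E(2) g' by metis
  have "low_defect_pair (subst3_poly ?q f) (subst3_cost ?q C)"
    unfolding low_defect_pair_def D' using q ts(2) ts(4)[of k] E(3)
    by (intro exI[of _ "tsubst i k E"]) auto
  moreover have "direct_truncation (?g, ?D) (subst3_poly ?q f, subst3_cost ?q C)"
    unfolding g' D' using p i by (intro direct_truncation.intros) (auto simp: partial_truncation_def)
  then have "truncation (f, C) (subst3_poly ?q f, subst3_cost ?q C)"
    using p unfolding partial_truncation_def truncation_def by (meson rtranclp.rtrancl_into_rtrancl)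
  moreover have "pvars (subst3_poly ?q f) = {..<r} - fixed_vars ?q"
    using pvars_expr_poly[OF ts(2)] pvars_expr_poly[OF E(1)] ts(1) pv E(2) unfolding q fixed by auto
  moreover have "nesting (subst3_poly ?q f) x y"
    if "x \<notin> fixed_vars ?q" "y \<notin> fixed_vars ?q" "nesting f x y" for x y
    using that trans[of x y] ts(5) nesting_expr_poly[OF ts(2)] nest unfolding q fixed by simp
  moreover have "downward_closed f (fixed_vars ?q)"
    unfolding downward_closed_def fixed
  proof (intro allI impI)
    fix x y assume y: "y \<in> insert i (fixed_vars p)" and xy: "nesting f x y"
    show "x \<in> insert i (fixed_vars p)"
    proof (cases "y \<in> fixed_vars p")
      case True
      then show ?thesis
        using p xy unfolding partial_truncation_def downward_closed_def by blast
    next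
      case False
      \<comment> \<open>Here \<open>y = i\<close>. An \<open>x\<close> that is not fixed would be
        nested below \<open>i\<close> in the truncated polynomial too, so minimality gives
        \<open>x = i\<close>.\<close>
      then show ?thesis
        using y xy trans imin ip by blast
    qed
  qed
  ultimately show ?thesis
    using len by (simp add: partial_truncation_def)
qed

text \<open>On \<open>points p\<close> the fixed coordinates are absorbed into the polynomial and
  their exponents into the cost, so the defect of \<open>(f, C)\<close> is that of the
  3-substitution at the remaining coordinates.\<close>

lemma delta_at_points:
  assumes f: "low_defect_pair f C" and p: "partial_truncation f C r p" and ns: "ns \<in> points p"
    and E: "low_defect_expr E" "expr_poly E = subst3_poly p f"
  shows "delta_at f C ns = real (subst3_cost p C) - 3 * log 3 (ratio (\<lambda>i. ns ! i) E)"
proof -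
  let ?\<sigma> = "\<lambda>i. 3 ^ (ns ! i) :: real"
  have len: "length p = r" "length ns = r" and fix_eq: "\<And>i. i \<in> fixed_vars p \<Longrightarrow> ns ! i = the (p ! i)"
    using p ns by (auto simp: partial_truncation_def points_def fixed_vars_def)
  have ev: "evars E = {..<r} - fixed_vars p"
    using p pvars_expr_poly[OF E(1)] E(2) by (simp add: partial_truncation_def)
  have "(\<lambda>i. peval ?\<sigma> (if i \<in> fixed_vars p then 3 ^ the (p ! i) else Var i)) = ?\<sigma>"
    by (auto simp: fun_eq_iff peval_simps fix_eq)
  then have "peval ?\<sigma> f = peval ?\<sigma> (subst3_poly p f)"
    unfolding subst3_poly_def peval_subst[OF f] by simp
  then have val: "peval ?\<sigma> f = ratio (\<lambda>i. ns ! i) E * 3 ^ (\<Sum>i \<in> evars E. ns ! i)"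
    by (simp add: ratio_def flip: E(2) peval_expr_poly)
  have "{..<r} = fixed_vars p \<union> evars E" "fixed_vars p \<inter> evars E = {}"
    using ev len by (auto simp: fixed_vars_def)
  then have "sum_list ns = (\<Sum>i \<in> fixed_vars p. ns ! i) + (\<Sum>i \<in> evars E. ns ! i)"
    using len(2) finite_fixed_vars finite_evars
    by (simp add: sum_list_sum_nth atLeast0LessThan sum.union_disjoint)
  also have "(\<Sum>i \<in> fixed_vars p. ns ! i) = (\<Sum>i \<in> fixed_vars p. the (p ! i))"
    using fix_eq by simp
  finally have "real (sum_list ns) =
      real (\<Sum>i \<in> fixed_vars p. the (p ! i)) + real (\<Sum>i \<in> evars E. ns ! i)"
    by simp
  moreover have "log 3 (peval ?\<sigma> f) = log 3 (ratio (\<lambda>i. ns ! i) E) + real (\<Sum>i \<in> evars E. ns ! i)"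
    unfolding val using ratio_pos[OF E(1), of "\<lambda>i. ns ! i"] by (simp add: log_mult log_nat_power)
  ultimately show ?thesis
    unfolding delta_at_def subst3_cost_def by (simp only: of_nat_add of_nat_mult) simp
qed

section \<open>The recursion on the number of remaining variables\<close>

lemma ratio_evars_empty: "evars E = {} \<Longrightarrow> ratio \<sigma> E = real (elead E)"
  by (simp add: ratio_def expr_val_const)

lemma points_update:
  assumes "i < length p" "i \<notin> fixed_vars p"
  shows "points (p[i := Some k]) = {ns \<in> points p. ns ! i = k}"
  using assms by (auto simp: points_def fixed_vars_def nth_list_update)

text \<open>Stated for an arbitrary partial truncation, so that the induction can pass to tuples
  with one more fixed coordinate.\<close>

lemma finite_cover:
  assumes f: "low_defect_pair f C" and p: "partial_truncation f C r p"
  shows "\<exists>T. finite T \<and> {ns \<in> points p. delta_at f C ns < s} = (\<Union>q \<in> T. points q) \<and>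
    (\<forall>q \<in> T. partial_truncation f C r q \<and> delta (subst3_poly q f) (subst3_cost q C) \<le> s \<and>
      (pdegree (subst3_poly q f) = 0 \<longrightarrow> delta (subst3_poly q f) (subst3_cost q C) < s))"
    (is "\<exists>T. finite T \<and> _ \<and> (\<forall>q \<in> T. ?good q)")
  using p
proof (induction "card (pvars (subst3_poly p f))" arbitrary: p rule: less_induct)
  case less
  let ?g = "subst3_poly p f" and ?D = "subst3_cost p C"
  obtain E where E: "low_defect_expr E" "expr_poly E = ?g"
    using less.prems low_defect_pairE unfolding partial_truncation_def by metis
  have dl: "delta ?g ?D = real ?D - 3 * log 3 (real (elead E))"
    using lead_expr_poly[OF E(1)] E(2) by (simp add: delta_def)
  have deg: "pdegree ?g = card (evars E)"
    using pdegree_expr_poly[OF E(1)] E(2) by simp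
  have pv: "pvars ?g = evars E" "evars E = {..<r} - fixed_vars p" "length p = r"
    using pvars_expr_poly[OF E(1)] E(2) less.prems by (auto simp: partial_truncation_def)
  note dat = delta_at_points[OF f less.prems _ E]
  consider (empty) "evars E = {}" | (small) "evars E \<noteq> {}" "delta ?g ?D \<le> s"
    | (large) "evars E \<noteq> {}" "delta ?g ?D > s" by fastforce
  then show ?case
  proof cases
    case empty
    \<comment> \<open>No star is left, so \<open>points p\<close> is a single point, and the cover
      is \<open>{p}\<close> or empty. Testing for \<open>< s\<close> gives the strict claim in
      degree 0.\<close>
    then have "delta_at f C ns = delta ?g ?D" if "ns \<in> points p" for ns
      using dat[OF that] dl by (simp add: ratio_evars_empty)
    then show ?thesis
      using less.prems by (intro exI[of _ "if delta ?g ?D < s then {p} else {}"]) auto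
  next
    case small
    have "delta_at f C ns < s" if "ns \<in> points p" for ns
    proof -
      \<comment> \<open>The ratio strictly exceeds \<open>elead E\<close>, so
        \<open>delta ?g ?D \<le> s\<close> already puts every point strictly below
        \<open>s\<close>.\<close>
      have "log 3 (real (elead E)) < log 3 (ratio (\<lambda>i. ns ! i) E)"
        using elead_less_ratio[OF E(1) small(1)] elead_pos[OF E(1)] by (intro log_less) auto
      then show ?thesis using dat[OF that] dl small(2) by simp
    qed
    moreover have "pdegree ?g \<noteq> 0"
      using deg small(1) finite_evars by simp
    ultimately show ?thesis
      using less.prems small(2) by (intro exI[of _ "{p}"]) auto
  next
    case large
    then have "3 * log 3 (real (elead E)) < real ?D - s"
      using dl by simp
    then obtain K where K: "\<And>\<sigma>. (\<And>i. i \<in> min_vars E \<Longrightarrow> K \<le> \<sigma> i) \<Longrightarrow>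
        3 * log 3 (ratio \<sigma> E) \<le> real ?D - s"
      using log_ratio_le[OF E(1)] by blast
    \<comment> \<open>A point with all minimal coordinates at least \<open>K\<close> has defect at
      least \<open>s\<close>. The other points are covered by fixing one minimal coordinate below
      \<open>K\<close>; these pieces may overlap.\<close>
    define Q where "Q = (\<Union>i \<in> min_vars E. (\<lambda>k. p[i := Some k]) ` {..<K})"
    have finQ: "finite Q"
      unfolding Q_def using finite_subset[OF min_vars_subset finite_evars] by auto
    have step: "i < length p" "i \<notin> fixed_vars p" if "i \<in> min_vars E" for i
      using that min_vars_subset[of E] pv by auto
    have "\<forall>q \<in> Q. \<exists>T. finite T \<and>
        {ns \<in> points q. delta_at f C ns < s} = (\<Union>q \<in> T. points q) \<and> (\<forall>q \<in> T. ?good q)"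
    proof
      fix q assume q_in: "q \<in> Q"
      obtain i k where ik: "i \<in> min_vars E" "q = p[i := Some k]"
        using q_in unfolding Q_def by blast
      have q: "partial_truncation f C r q"
        unfolding ik(2) using nesting_minimal_min_vars[OF E(1) ik(1)] E(2)
        by (intro partial_truncation_update[OF f less.prems]) simp
      then have "pvars (subst3_poly q f) = {..<r} - fixed_vars q"
        by (simp add: partial_truncation_def)
      then have "pvars (subst3_poly q f) = evars E - {i}" "i \<in> evars E"
        using pv step[OF ik(1)] fixed_vars_update[of i p k] ik by auto
      then have "card (pvars (subst3_poly q f)) < card (pvars ?g)"
        unfolding pv(1) by (simp add: card_Diff1_less finite_evars del: card_Diff_insert)
      from less.hyps[OF this q]
      show "\<exists>T. finite T \<and>
        {ns \<in> points q. delta_at f C ns < s} = (\<Union>q \<in> T. points q) \<and> (\<forall>q \<in> T. ?good q)" .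
    qed
    from bchoice[OF this] obtain T where T_all: "\<forall>q \<in> Q. finite (T q) \<and>
        {ns \<in> points q. delta_at f C ns < s} = (\<Union>q \<in> T q. points q) \<and> (\<forall>q \<in> T q. ?good q)"
      by blast
    then have T: "\<And>q. q \<in> Q \<Longrightarrow> finite (T q)"
      "\<And>q. q \<in> Q \<Longrightarrow> {ns \<in> points q. delta_at f C ns < s} = (\<Union>q \<in> T q. points q)"
      "\<And>q q'. q \<in> Q \<Longrightarrow> q' \<in> T q \<Longrightarrow> ?good q'"
      by blast+
    have "{ns \<in> points p. delta_at f C ns < s} = (\<Union>q \<in> Q. {ns \<in> points q. delta_at f C ns < s})"
    proof (intro equalityI subsetI)
      fix ns assume ns: "ns \<in> {ns \<in> points p. delta_at f C ns < s}"
      then have "\<not> 3 * log 3 (ratio (\<lambda>i. ns ! i) E) \<le> real ?D - s"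
        using dat[of ns] by simp
      then obtain i where i: "i \<in> min_vars E" "ns ! i < K"
        using K by (meson not_le)
      then have "p[i := Some (ns ! i)] \<in> Q"
        by (auto simp: Q_def)
      moreover have "ns \<in> points (p[i := Some (ns ! i)])"
        using ns points_update[OF step[OF i(1)]] by simp
      ultimately show "ns \<in> (\<Union>q \<in> Q. {ns \<in> points q. delta_at f C ns < s})"
        using ns by blast
    next
      fix ns assume "ns \<in> (\<Union>q \<in> Q. {ns \<in> points q. delta_at f C ns < s})"
      then show "ns \<in> {ns \<in> points p. delta_at f C ns < s}"
        using points_update[OF step] by (auto simp: Q_def)
    qed
    also have "\<dots> = (\<Union>q \<in> (\<Union>q \<in> Q. T q). points q)"
      using T(2) by auto
    finally have "{ns \<in> points p. delta_at f C ns < s} = (\<Union>q \<in> (\<Union>q \<in> Q. T q). points q)" .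
    moreover have "finite (\<Union>q \<in> Q. T q)"
      using finQ T(1) by (rule finite_UN_I)
    moreover have "\<forall>q \<in> (\<Union>q \<in> Q. T q). ?good q"
      using T(3) by (meson UN_E)
    ultimately show ?thesis
      by (intro exI[of _ "\<Union>q \<in> Q. T q"] conjI)
  qed
qed

section \<open>Degree bounded by the defect, and the conclusion\<close>

lemma pdegree_le_delta:
  assumes "low_defect_pair f C"
  shows "real (pdegree f) \<le> delta f C"
  using assms
proof (rule low_defect_pairE)
  fix E assume E: "low_defect_expr E" "expr_poly E = f" "expr_complexity E \<le> C"
  have "real (expr_complexity E) \<le> real C" using E(3) by simp
  then show ?thesis
    using expr_complexity_ge[OF E(1)] pdegree_expr_poly[OF E(1)] lead_expr_poly[OF E(1)] E(2)
    by (simp add: delta_def)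
qed

theorem theorem4p8:
  fixes f :: npoly and C r :: nat and s :: real
  assumes "low_defect_pair f C"
    and "pdegree f = r"
    and "pvars f = {..<r}"
    and "s \<ge> 0"
  shows "\<exists>T :: nat option list set.
    finite T \<and> (\<forall>p \<in> T. length p = r) \<and>
    {ns. length ns = r \<and> delta_at f C ns < s} = (\<Union>p \<in> T. points p) \<and>
    (\<forall>p \<in> T.
      downward_closed f (fixed_vars p) \<and>
      (let g = subst3_poly p f; D = subst3_cost p C in
        truncation (f, C) (g, D) \<and>
        delta g D \<le> s \<and>
        int (pdegree g) \<le> \<lfloor>s\<rfloor> \<and>
        (pdegree g = 0 \<longrightarrow> delta g D < s)))"
proof -
  \<comment> \<open>The recursion is started at the tuple of stars, which stands for all
    points.\<close>
  have "points (replicate r None) = {ns. length ns = r}"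
    by (auto simp: points_def)
  then obtain T where T: "finite T"
    "{ns. length ns = r \<and> delta_at f C ns < s} = (\<Union>q \<in> T. points q)"
    "\<And>q. q \<in> T \<Longrightarrow> partial_truncation f C r q \<and> delta (subst3_poly q f) (subst3_cost q C) \<le> s \<and>
      (pdegree (subst3_poly q f) = 0 \<longrightarrow> delta (subst3_poly q f) (subst3_cost q C) < s)"
    using finite_cover[OF assms(1) partial_truncation_replicate[OF assms(1,3)], of s] by auto
  have "int (pdegree (subst3_poly q f)) \<le> \<lfloor>s\<rfloor>" if "q \<in> T" for q
  proof -
    have "real (pdegree (subst3_poly q f)) \<le> s"
      using T(3)[OF that] pdegree_le_delta unfolding partial_truncation_def by (meson order.trans)
    then show ?thesis by (simp add: le_floor_iff)
  qed
  then show ?thesis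
    using T unfolding partial_truncation_def Let_def by (intro exI[of _ T]) blast
qed

end
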